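(* Let $k\geqslant1$, let $m(k)=\lceil k^2/2+2k+1\rceil$, and for $i=1,\dots,m(k)$ define $\sigma_k(i)=i(k+2)\bmod (m(k)+1)$ if $k$ is odd and $\sigma_k(i)=i(k+1)\bmod (m(k)+1)$ if $k$ is even (residues taken in $\{0,\dots,m(k)\}$). Then $\sigma_k$, which is a permutation of $[m(k)]$, is $k$-prolific.
   Context: $S_n$ is the set of permutations of $[n]$, in one-line notation. A permutation $\sigma\in S_n$ contains $\pi\in S_r$ ($\pi\preceq\sigma$) if there are indices $i_1<\dots<i_r$ with $\sigma(i_1)\cdots\sigma(i_r)$ in the same relative order as $\pi$; for $n>k\geqslant1$, $\sigma$ is $k$-prolific if $|\{\pi\in S_{n-k}:\pi\preceq\sigma\}|=\binom{n}{k}$. *)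

theory Defs
  imports Complex_Main "HOL-Combinatorics.Permutations"
begin

text \<open>
  A permutation of \<open>[n]\<close> is a function \<open>\<sigma>\<close> with \<open>\<sigma> permutes {1..n}\<close>, i.e. it is the identity
  outside \<open>{1..n}\<close>. This normalisation makes distinct elements of the symmetric group distinct
  functions, so that cardinalities of sets of permutations are the intended ones.
\<close>

text \<open>The function \<open>f\<close> picks the positions \<open>f 1 < \<dots> < f r\<close> of an occurrence of \<open>\<pi>\<close> in \<open>\<sigma>\<close>.\<close>

definition pattern_contained :: "nat \<Rightarrow> (nat \<Rightarrow> nat) \<Rightarrow> nat \<Rightarrow> (nat \<Rightarrow> nat) \<Rightarrow> bool" where
  "pattern_contained r \<pi> n \<sigma> \<longleftrightarrow>
     (\<exists>f. strict_mono_on {1..r} f \<and> f ` {1..r} \<subseteq> {1..n} \<and>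
          (\<forall>a\<in>{1..r}. \<forall>b\<in>{1..r}. \<sigma> (f a) < \<sigma> (f b) \<longleftrightarrow> \<pi> a < \<pi> b))"

definition prolific :: "nat \<Rightarrow> nat \<Rightarrow> (nat \<Rightarrow> nat) \<Rightarrow> bool" where
  "prolific k n \<sigma> \<longleftrightarrow>
     1 \<le> k \<and> k < n \<and> \<sigma> permutes {1..n} \<and>
     card {\<pi>. \<pi> permutes {1..n - k} \<and> pattern_contained (n - k) \<pi> n \<sigma>} = n choose k"

definition m_size :: "nat \<Rightarrow> nat" where
  "m_size k = nat \<lceil>(real k)\<^sup>2 / 2 + 2 * real k + 1\<rceil>"

definition sigma_perm :: "nat \<Rightarrow> nat \<Rightarrow> nat" where
  "sigma_perm k i =
     (if i \<in> {1..m_size k}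
      then (if odd k then (i * (k + 2)) mod (m_size k + 1) else (i * (k + 1)) mod (m_size k + 1))
      else i)"

end

theory Submission
  imports Defs "HOL-Number_Theory.Cong"
begin

text \<open>
  Suppose two different sets of \<open>k\<close> deletions leave the same pattern. Matching the remaining points
  in order, each point of the first copy is shifted by at most \<open>k\<close> in either coordinate to reach
  its partner in the second copy. All differences of points of \<open>\<sigma>\<^sub>k\<close> lie in the lattice
  \<open>{(p, q). q \<equiv> c p (mod m(k) + 1)}\<close>, whose only nonzero vectors in the box \<open>[-k, k]\<^sup>2\<close> are, up to
  sign, \<open>(h + 1, h)\<close> and \<open>(h, -(h + 1))\<close> for \<open>k = 2 h - 1\<close>, and \<open>(h + 1, h - 1)\<close> and \<open>(h, -h)\<close>
  for \<open>k = 2 h - 2\<close>; each has \<open>\<ell>\<^sub>1\<close>-norm \<open>k + 2\<close>.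

  If the rightmost shifted point moves right, every position it jumps over was deleted in the first
  copy, and likewise for the values above the topmost shifted point if that moves up. Shifts in
  opposite directions would together force more than \<open>k\<close> deletions, so all shifts go right. If the
  topmost point moves up, either the rightmost point moves down, again an excess of deletions
  counted by value, or both move by the same vector \<open>(p, q)\<close>; then \<open>p\<close> deleted positions and \<open>q\<close>
  deleted values share at most one point, because the box they span is smaller than the minimum
  distance \<open>k + 2\<close>, and there are at least \<open>p + q - 1 = k + 1\<close> deletions. If it moves down,
  exchange the two copies and reflect the positions.
\<close>

section \<open>Shifts and deletions along one coordinate axis\<close>

text \<open>\<open>A\<close> indexes the surviving points; \<open>x\<close> and \<open>x'\<close>
  give one coordinate of their places in the two copies. Both positions and values are treated this
  way.\<close>

locale order_twins =
  fixes n k :: nat and A :: "'a set" and x x' :: "'a \<Rightarrow> int"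
  assumes finite_index: "finite A"
    and card_index: "card A + k = n"
    and range: "a \<in> A \<Longrightarrow> x a \<in> {1..int n}"
    and range': "a \<in> A \<Longrightarrow> x' a \<in> {1..int n}"
    and inj: "inj_on x A"
    and order: "a \<in> A \<Longrightarrow> b \<in> A \<Longrightarrow> x a < x b \<longleftrightarrow> x' a < x' b"
begin

lemma inj': "inj_on x' A"
proof (rule inj_onI)
  fix a b assume "a \<in> A" "b \<in> A" "x' a = x' b"
  then have "x a = x b" using order[of a b] order[of b a] by force
  then show "a = b" using inj \<open>a \<in> A\<close> \<open>b \<in> A\<close> by (auto dest: inj_onD)
qed

lemma swap: "order_twins n k A x' x"
  using finite_index card_index range range' inj' order by unfold_locales auto

lemma reflect: "order_twins n k A (\<lambda>a. int n + 1 - x a) (\<lambda>a. int n + 1 - x' a)"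
proof
  show "inj_on (\<lambda>a. int n + 1 - x a) A" using inj by (auto simp: inj_on_def)
qed (use finite_index card_index range range' order in \<open>auto simp: Ball_def\<close>)

lemma card_deleted: "card ({1..int n} - x ` A) = k"
proof -
  have "card ({1..int n} - x ` A) = card {1..int n} - card (x ` A)"
    using range finite_index by (intro card_Diff_subset) auto
  also have "card (x ` A) = card A" using inj by (rule card_image)
  finally show ?thesis using card_index by simp
qed

text \<open>In the second copy the survivors below \<open>a\<close> fit below \<open>x' a\<close>,
  so they occupy at most \<open>x' a - 1\<close> of the \<open>x a - 1\<close> places below
  \<open>x a\<close> in the first.\<close>

lemma card_deleted_below:
  assumes "a \<in> A"
  shows "x a - x' a \<le> int (card ({1..<x a} - x ` A))"
proof -
  let ?B = "{b \<in> A. x b < x a}"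
  have "{1..<x a} - x ` A = {1..<x a} - x ` ?B" by auto
  then have "card ({1..<x a} - x ` A) = card {1..<x a} - card (x ` ?B)"
    using range finite_index by (simp only:, intro card_Diff_subset) auto
  moreover have "card (x ` ?B) = card ?B"
    using inj by (intro card_image) (auto simp: inj_on_def)
  moreover have "card ?B = card (x' ` ?B)"
    using inj' by (intro card_image[symmetric]) (auto simp: inj_on_def)
  moreover have "card (x' ` ?B) \<le> card {1..<x' a}"
    using range' order assms by (intro card_mono) auto
  ultimately show ?thesis using range[OF assms] range'[OF assms] by auto
qed

lemma shift_le: "a \<in> A \<Longrightarrow> x a - x' a \<le> int k"
proof -
  assume a: "a \<in> A"
  have "card ({1..<x a} - x ` A) \<le> card ({1..int n} - x ` A)"
    using range[OF a] by (intro card_mono) auto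
  then show ?thesis using card_deleted card_deleted_below[OF a] by simp
qed

text \<open>A survivor beyond \<open>x r\<close> is fixed, and preservation of order puts it beyond
  \<open>x' r\<close> too.\<close>

lemma run_deleted:
  assumes "r \<in> A" and "\<And>b. b \<in> A \<Longrightarrow> x r < x b \<Longrightarrow> x' b = x b"
  shows "{x r<..x' r} \<subseteq> {1..int n} - x ` A"
proof
  fix i assume i: "i \<in> {x r<..x' r}"
  have "i \<noteq> x b" if "b \<in> A" for b
    using assms(2)[OF that] order[OF assms(1) that] i by auto
  then show "i \<in> {1..int n} - x ` A"
    using i range[OF assms(1)] range'[OF assms(1)] by auto
qed

text \<open>The left-moving \<open>t\<close> starts no further right than \<open>r\<close>, so the
  deletions below \<open>t\<close> are disjoint from the run above \<open>r\<close> and the counts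
  add up.\<close>

lemma opposite_shifts_le:
  assumes "r \<in> A" and "\<And>b. b \<in> A \<Longrightarrow> x r < x b \<Longrightarrow> x' b = x b"
    and "x r < x' r" and "t \<in> A" and "x' t < x t"
  shows "(x' r - x r) + (x t - x' t) \<le> int k"
proof -
  let ?D = "{1..<x t} - x ` A"
  have "x t \<le> x r" using assms(2)[OF assms(4)] assms(5) by force
  then have disj: "{x r<..x' r} \<inter> ?D = {}" by auto
  have "{x r<..x' r} \<union> ?D \<subseteq> {1..int n} - x ` A"
    using run_deleted[OF assms(1,2)] range[OF assms(4)] by auto
  then have "card ({x r<..x' r} \<union> ?D) \<le> k"
    using card_mono[of "{1..int n} - x ` A"] card_deleted by simp
  then have "card {x r<..x' r} + card ?D \<le> k"
    using disj by (simp add: card_Un_disjoint)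
  then show ?thesis using card_deleted_below[OF assms(4)] assms(3) by simp
qed

end

section \<open>Points shifted in both coordinates\<close>

text \<open>
  Shifts of positive slope are \<open>(\<plusminus>\<alpha>, \<plusminus>\<beta>)\<close>, those of negative slope \<open>(\<plusminus>\<gamma>, \<mp>\<delta>)\<close>. The conditions on
  the sizes are symmetric under exchanging the two kinds, as happens under reflection.
\<close>

locale pattern_twins =
  X: order_twins n k A x x' + Y: order_twins n k A "\<lambda>a. s (x a)" "\<lambda>a. s (x' a)"
  for n k :: nat and A :: "'a set" and x x' :: "'a \<Rightarrow> int" and s :: "int \<Rightarrow> int" +
  fixes \<alpha> \<beta> \<gamma> \<delta> :: int
  assumes bij: "bij_betw s {1..int n} {1..int n}"
    and separated: "i \<in> {1..int n} \<Longrightarrow> j \<in> {1..int n} \<Longrightarrow> i \<noteq> j \<Longrightarrow>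
      int k + 2 \<le> \<bar>i - j\<bar> + \<bar>s i - s j\<bar>"
    and shift: "a \<in> A \<Longrightarrow> x' a \<noteq> x a \<Longrightarrow>
      \<bar>x' a - x a\<bar> = \<alpha> \<and> \<bar>s (x' a) - s (x a)\<bar> = \<beta> \<and>
        (x a < x' a \<longleftrightarrow> s (x a) < s (x' a)) \<or>
      \<bar>x' a - x a\<bar> = \<gamma> \<and> \<bar>s (x' a) - s (x a)\<bar> = \<delta> \<and>
        (x a < x' a \<longleftrightarrow> s (x' a) < s (x a))"
    and sizes: "\<alpha> + \<beta> = int k + 2" "\<gamma> + \<delta> = int k + 2"
      "int k < 2 * \<alpha>" "int k < 2 * \<gamma>" "int k < \<beta> + \<delta>"
begin

lemma moved_iff: "a \<in> A \<Longrightarrow> s (x' a) = s (x a) \<longleftrightarrow> x' a = x a"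
  using inj_onD[OF bij_betw_imp_inj_on[OF bij], of "x a" "x' a"] X.range[of a] X.range'[of a]
  by auto

lemma swap: "pattern_twins n k A x' x s \<alpha> \<beta> \<gamma> \<delta>"
proof -
  interpret X': order_twins n k A x' x by (rule X.swap)
  interpret Y': order_twins n k A "\<lambda>a. s (x' a)" "\<lambda>a. s (x a)" by (rule Y.swap)
  show ?thesis
  proof
    fix a assume "a \<in> A" "x a \<noteq> x' a"
    then show "\<bar>x a - x' a\<bar> = \<alpha> \<and> \<bar>s (x a) - s (x' a)\<bar> = \<beta> \<and>
        (x' a < x a \<longleftrightarrow> s (x' a) < s (x a)) \<or>
      \<bar>x a - x' a\<bar> = \<gamma> \<and> \<bar>s (x a) - s (x' a)\<bar> = \<delta> \<and>
        (x' a < x a \<longleftrightarrow> s (x a) < s (x' a))"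
      using shift[of a] moved_iff[of a] by (auto simp: abs_minus_commute)
  qed (use bij separated sizes in auto)
qed

text \<open>Reversing positions changes the sign of every slope, which exchanges the two kinds of
  shift; composing \<open>s\<close> with the reversal keeps the value of every point.\<close>

lemma reflect:
  "pattern_twins n k A (\<lambda>a. int n + 1 - x a) (\<lambda>a. int n + 1 - x' a) (\<lambda>i. s (int n + 1 - i)) \<gamma> \<delta> \<alpha> \<beta>"
proof -
  interpret X': order_twins n k A "\<lambda>a. int n + 1 - x a" "\<lambda>a. int n + 1 - x' a" by (rule X.reflect)
  have "bij_betw (\<lambda>i. int n + 1 - i) {1..int n} {1..int n}"
    by (rule bij_betw_byWitness[where f' = "\<lambda>i. int n + 1 - i"]) auto
  from bij_betw_trans[OF this bij]
  have bij': "bij_betw (\<lambda>i. s (int n + 1 - i)) {1..int n} {1..int n}" by (simp add: comp_def)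
  show ?thesis
  proof
    fix i j assume "i \<in> {1..int n}" "j \<in> {1..int n}" "i \<noteq> j"
    then show "int k + 2 \<le> \<bar>i - j\<bar> + \<bar>s (int n + 1 - i) - s (int n + 1 - j)\<bar>"
      using separated[of "int n + 1 - i" "int n + 1 - j"] by auto
  next
    fix a assume "a \<in> A" "int n + 1 - x' a \<noteq> int n + 1 - x a"
    then show "\<bar>int n + 1 - x' a - (int n + 1 - x a)\<bar> = \<gamma> \<and>
        \<bar>s (int n + 1 - (int n + 1 - x' a)) - s (int n + 1 - (int n + 1 - x a))\<bar> = \<delta> \<and>
        (int n + 1 - x a < int n + 1 - x' a \<longleftrightarrow>
          s (int n + 1 - (int n + 1 - x a)) < s (int n + 1 - (int n + 1 - x' a))) \<or>
      \<bar>int n + 1 - x' a - (int n + 1 - x a)\<bar> = \<alpha> \<and>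
        \<bar>s (int n + 1 - (int n + 1 - x' a)) - s (int n + 1 - (int n + 1 - x a))\<bar> = \<beta> \<and>
        (int n + 1 - x a < int n + 1 - x' a \<longleftrightarrow>
          s (int n + 1 - (int n + 1 - x' a)) < s (int n + 1 - (int n + 1 - x a)))"
      using shift[of a] moved_iff[of a] by (auto simp: abs_minus_commute)
  next
    show "inj_on (\<lambda>a. s (int n + 1 - (int n + 1 - x a))) A" using Y.inj by simp
  qed (use bij' X.finite_index X.card_index Y.range Y.range' Y.order sizes in auto)
qed

text \<open>Every horizontal shift has size \<open>\<alpha>\<close> or \<open>\<gamma>\<close>, each
  more than \<open>k / 2\<close>, so two opposite ones would exceed \<open>k\<close> in
  total.\<close>

lemma all_right:
  assumes "r \<in> A" and "\<And>b. b \<in> A \<Longrightarrow> x r < x b \<Longrightarrow> x' b = x b" and "x r < x' r"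
    and "a \<in> A"
  shows "x a \<le> x' a"
proof (rule ccontr)
  assume "\<not> x a \<le> x' a"
  then have "(x' r - x r) + (x a - x' a) \<le> int k"
    using assms by (intro X.opposite_shifts_le) auto
  moreover have "x' r - x r \<in> {\<alpha>, \<gamma>}" "x a - x' a \<in> {\<alpha>, \<gamma>}"
    using shift[OF assms(1)] shift[OF assms(4)] assms(3) \<open>\<not> x a \<le> x' a\<close> by auto
  ultimately show False using sizes by auto
qed

lemma rightmost_topmost_impossible:
  assumes r: "r \<in> A" "\<And>b. b \<in> A \<Longrightarrow> x r < x b \<Longrightarrow> x' b = x b" "x r < x' r"
    and t: "t \<in> A" "\<And>b. b \<in> A \<Longrightarrow> s (x t) < s (x b) \<Longrightarrow> x' b = x b" "s (x t) < s (x' t)"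
  shows False
proof -
  have t_top: "s (x' b) = s (x b)" if "b \<in> A" "s (x t) < s (x b)" for b
    using t(2)[OF that] by simp
  have "x t \<noteq> x' t" using t(3) by auto
  then have "x t < x' t" using all_right[OF r t(1)] by simp
  then have t_shift: "x' t - x t = \<alpha>" "s (x' t) - s (x t) = \<beta>"
    using shift[OF t(1)] t(3) by auto
  show False
  proof (cases "s (x r) < s (x' r)")
    case False
    \<comment> \<open>On the value axis \<open>r\<close> moves down by \<open>\<delta>\<close> and
      the topmost \<open>t\<close> moves up by \<open>\<beta>\<close>, together more than
      \<open>k\<close>.\<close>
    then have "s (x' r) < s (x r)" using moved_iff[OF r(1)] r(3) by auto
    moreover from this have "s (x r) - s (x' r) = \<delta>" using shift[OF r(1)] r(3) by auto
    ultimately show False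
      using Y.opposite_shifts_le[OF t(1) t_top t(3) r(1)] t_shift sizes by auto
  next
    case True
    then have r_shift: "x' r - x r = \<alpha>" "s (x' r) - s (x r) = \<beta>"
      using shift[OF r(1)] r(3) by auto
    \<comment> \<open>\<open>I\<close> collects the positions that \<open>r\<close> jumps over,
      \<open>J\<close> the positions of the values that \<open>t\<close> jumps over.\<close>
    define I where "I = {x r<..x' r}"
    define J where "J = {i \<in> {1..int n}. s i \<in> {s (x t)<..s (x' t)}}"
    let ?D = "{1..int n} - x ` A"
    have Y_run: "{s (x t)<..s (x' t)} \<subseteq> {1..int n} - (\<lambda>a. s (x a)) ` A"
      using Y.run_deleted[OF t(1) t_top] .
    have sub: "I \<union> J \<subseteq> ?D"
      using X.run_deleted[OF r(1,2)] Y_run by (auto simp: I_def J_def)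
    have "s ` J = {s (x t)<..s (x' t)}"
      using Y_run bij by (fastforce simp: J_def bij_betw_def)
    moreover have "inj_on s J"
      using bij by (auto simp: J_def bij_betw_def intro: inj_on_subset)
    ultimately have "int (card J) = \<beta>" using card_image[of s J] t_shift t(3) by simp
    moreover have "int (card I) = \<alpha>" using r_shift r(3) by (simp add: I_def)
    moreover have "card (I \<inter> J) \<le> 1"
    proof -
      \<comment> \<open>Two common elements differ by at most \<open>\<alpha> - 1\<close> in
        position and \<open>\<beta> - 1\<close> in value, hence lie at distance at most
        \<open>k\<close>.\<close>
      have "i = j" if "i \<in> I \<inter> J" "j \<in> I \<inter> J" for i j
        using that separated[of i j] r_shift t_shift sizes(1)
        by (force simp: I_def J_def)
      moreover have "finite (I \<inter> J)" by (simp add: I_def)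
      ultimately show ?thesis by (auto simp: card_le_Suc0_iff_eq)
    qed
    moreover have "card I + card J = card (I \<union> J) + card (I \<inter> J)"
      using sub by (intro card_Un_Int) (auto intro: finite_subset)
    moreover have "card (I \<union> J) \<le> k"
      using card_mono[OF _ sub] X.card_deleted by simp
    ultimately show False using sizes(1) by linarith
  qed
qed

text \<open>Otherwise the topmost moved point \<open>t\<close> moves down. Exchanging the copies and
  reversing positions makes \<open>t\<close> move up and makes the leftmost moved point
  \<open>l\<close> the rightmost one, moving right, which is already excluded.\<close>

lemma rightmost_not_right:
  assumes "r \<in> A" "\<And>b. b \<in> A \<Longrightarrow> x r < x b \<Longrightarrow> x' b = x b"
  shows "\<not> x r < x' r"
proof
  assume r_right: "x r < x' r"
  define M where "M = {a \<in> A. x' a \<noteq> x a}"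
  have M: "finite M" "M \<noteq> {}" using X.finite_index assms(1) r_right by (auto simp: M_def)
  obtain t where t: "t \<in> M" "\<And>b. b \<in> M \<Longrightarrow> s (x b) \<le> s (x t)"
    using obtains_MAX[OF M, of "\<lambda>a. s (x a)"] M(1) by (metis Max_ge finite_imageI image_eqI)
  then have t_top: "\<And>b. b \<in> A \<Longrightarrow> s (x t) < s (x b) \<Longrightarrow> x' b = x b"
    by (force simp: M_def)
  obtain l where l: "l \<in> M" "\<And>b. b \<in> M \<Longrightarrow> x l \<le> x b"
    using obtains_MIN[OF M, of x] M(1) by (metis Min_le finite_imageI image_eqI)
  then have l_left: "\<And>b. b \<in> A \<Longrightarrow> x b < x l \<Longrightarrow> x' b = x b"
    by (force simp: M_def)
  have "x l < x' l"
    using all_right[OF assms r_right, of l] l by (auto simp: M_def)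
  have "\<not> s (x t) < s (x' t)"
    using rightmost_topmost_impossible[OF assms r_right _ t_top] t by (auto simp: M_def)
  then have t_down: "s (x' t) < s (x t)" using moved_iff[of t] t by (auto simp: M_def)
  interpret S: pattern_twins n k A x' x s \<alpha> \<beta> \<gamma> \<delta> by (rule swap)
  interpret F: pattern_twins n k A "\<lambda>a. int n + 1 - x' a" "\<lambda>a. int n + 1 - x a"
    "\<lambda>i. s (int n + 1 - i)" \<gamma> \<delta> \<alpha> \<beta> by (rule S.reflect)
  show False
  proof (rule F.rightmost_topmost_impossible[of l t])
    \<comment> \<open>\<open>l\<close> and \<open>t\<close> are extremal in the first copy;
      preservation of order carries this over to the second.\<close>
    fix b assume "b \<in> A" "int n + 1 - x' l < int n + 1 - x' b"
    then show "int n + 1 - x b = int n + 1 - x' b"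
      using l l_left[of b] X.order[of b l] by (auto simp: M_def)
  next
    fix b assume "b \<in> A" "s (int n + 1 - (int n + 1 - x' t)) < s (int n + 1 - (int n + 1 - x' b))"
    then show "int n + 1 - x b = int n + 1 - x' b"
      using t t_top[of b] Y.order[of t b] by (auto simp: M_def)
  qed (use l t t_down \<open>x l < x' l\<close> in \<open>auto simp: M_def\<close>)
qed

lemma twins_equal:
  assumes "a \<in> A"
  shows "x' a = x a"
proof (rule ccontr)
  assume a: "x' a \<noteq> x a"
  define M where "M = {a \<in> A. x' a \<noteq> x a}"
  have M: "finite M" "M \<noteq> {}" using X.finite_index assms a by (auto simp: M_def)
  obtain r where r: "r \<in> M" "\<And>b. b \<in> M \<Longrightarrow> x b \<le> x r"
    using obtains_MAX[OF M, of x] M(1) by (metis Max_ge finite_imageI image_eqI)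
  then have r_max: "\<And>b. b \<in> A \<Longrightarrow> x r < x b \<Longrightarrow> x' b = x b"
    by (force simp: M_def)
  interpret S: pattern_twins n k A x' x s \<alpha> \<beta> \<gamma> \<delta> by (rule swap)
  have "\<not> x r < x' r" using rightmost_not_right r r_max by (auto simp: M_def)
  \<comment> \<open>A move to the left becomes a move to the right when the copies are
    exchanged.\<close>
  moreover have "\<not> x' r < x r"
  proof (rule S.rightmost_not_right)
    fix b assume "b \<in> A" "x' r < x' b"
    then show "x b = x' b" using r r_max[of b] X.order[of r b] by (auto simp: M_def)
  qed (use r in \<open>auto simp: M_def\<close>)
  ultimately show False using r by (auto simp: M_def)
qed

end

section \<open>Ranks, increasing enumerations and patterns\<close>

text \<open>Ranks serve to list a set of positions increasingly and to standardise a word to a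
  permutation.\<close>

lemma
  fixes h :: "'a \<Rightarrow> 'b::linorder"
  assumes "finite A" and "inj_on h A"
  defines "\<rho> \<equiv> \<lambda>a. card {b \<in> A. h b \<le> h a}"
  shows rank_less_iff: "\<And>a b. a \<in> A \<Longrightarrow> b \<in> A \<Longrightarrow> \<rho> a < \<rho> b \<longleftrightarrow> h a < h b"
    and bij_betw_rank: "bij_betw \<rho> A {1..card A}"
proof -
  have mono: "\<rho> a < \<rho> b" if "a \<in> A" "b \<in> A" "h a < h b" for a b
    unfolding \<rho>_def using that assms(1) by (intro psubset_card_mono) force+
  show less_iff: "\<rho> a < \<rho> b \<longleftrightarrow> h a < h b" if "a \<in> A" "b \<in> A" for a b
    using mono[of a b] mono[of b a] that inj_onD[OF assms(2), of a b]
    by (cases "h a" "h b" rule: linorder_cases) auto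
  have "inj_on \<rho> A"
    using less_iff inj_onD[OF assms(2)] by (metis inj_onI linorder_neqE nat_neq_iff)
  moreover have "\<rho> ` A \<subseteq> {1..card A}"
    using assms(1) by (auto simp: \<rho>_def Suc_le_eq card_gt_0_iff intro!: card_mono)
  ultimately show "bij_betw \<rho> A {1..card A}"
    by (simp add: bij_betw_def card_image card_subset_eq)
qed

lemma strict_mono_on_card_le:
  fixes f :: "nat \<Rightarrow> nat"
  assumes "strict_mono_on {1..r} f" and "a \<in> {1..r}"
  shows "card {c \<in> f ` {1..r}. c \<le> f a} = a"
proof -
  have "{c \<in> f ` {1..r}. c \<le> f a} = f ` {1..a}"
    using assms by (auto simp: strict_mono_on_leD strict_mono_on_less_eq image_iff)
  moreover have "inj_on f {1..a}"
    using strict_mono_on_imp_inj_on[OF assms(1)] by (rule inj_on_subset) (use assms(2) in auto)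
  ultimately show ?thesis by (simp add: card_image)
qed

text \<open>Each index is the rank of its entry in the image, so the image determines the
  enumeration.\<close>

lemma strict_mono_on_eqI:
  fixes f g :: "nat \<Rightarrow> nat"
  assumes "strict_mono_on {1..r} f" and "strict_mono_on {1..r} g"
    and "f ` {1..r} = g ` {1..r}" and "a \<in> {1..r}"
  shows "f a = g a"
proof -
  obtain b where b: "b \<in> {1..r}" "f a = g b" using assms(3,4) by blast
  have "a = b"
    using strict_mono_on_card_le[OF assms(1,4)] strict_mono_on_card_le[OF assms(2) b(1)] b(2) assms(3)
    by simp
  then show ?thesis using b by simp
qed

text \<open>The value at \<open>a\<close> counts the values not exceeding it, which depends only on
  relative order.\<close>

lemma permutes_eqI:
  fixes \<pi> \<pi>' :: "nat \<Rightarrow> nat"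
  assumes "\<pi> permutes {1..r}" and "\<pi>' permutes {1..r}"
    and "\<And>a b. a \<in> {1..r} \<Longrightarrow> b \<in> {1..r} \<Longrightarrow> \<pi> a < \<pi> b \<longleftrightarrow> \<pi>' a < \<pi>' b"
  shows "\<pi> = \<pi>'"
proof
  fix a
  have card_le: "card {b \<in> {1..r}. p b \<le> p a} = p a" if p: "p permutes {1..r}" and a: "a \<in> {1..r}" for p
  proof -
    have "p ` {b \<in> {1..r}. p b \<le> p a} = {c \<in> p ` {1..r}. c \<le> p a}" by auto
    also have "\<dots> = {1..p a}" using permutes_image[OF p] permutes_in_image[OF p, of a] a by auto
    finally show ?thesis
      using card_image[OF inj_on_subset[OF permutes_inj_on[OF p]], of "{b \<in> {1..r}. p b \<le> p a}" UNIV]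
      by simp
  qed
  show "\<pi> a = \<pi>' a"
  proof (cases "a \<in> {1..r}")
    case True
    then have "{b \<in> {1..r}. \<pi> b \<le> \<pi> a} = {b \<in> {1..r}. \<pi>' b \<le> \<pi>' a}"
      using assms(3) by (force simp: not_less[symmetric])
    then show ?thesis using card_le[OF assms(1) True] card_le[OF assms(2) True] by simp
  next
    case False
    then show ?thesis using assms(1,2) by (simp add: permutes_not_in)
  qed
qed

text \<open>Each set of \<open>n - k\<close> positions yields a pattern, and \<open>unique\<close>
  makes this assignment injective.\<close>

lemma prolificI:
  assumes "1 \<le> k" and "k < n" and \<sigma>: "\<sigma> permutes {1..n}"
    and unique: "\<And>f g. strict_mono_on {1..n - k} f \<Longrightarrow> strict_mono_on {1..n - k} g \<Longrightarrow>
      f ` {1..n - k} \<subseteq> {1..n} \<Longrightarrow> g ` {1..n - k} \<subseteq> {1..n} \<Longrightarrow>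
      (\<And>a b. a \<in> {1..n - k} \<Longrightarrow> b \<in> {1..n - k} \<Longrightarrow>
        \<sigma> (f a) < \<sigma> (f b) \<longleftrightarrow> \<sigma> (g a) < \<sigma> (g b)) \<Longrightarrow>
      f ` {1..n - k} = g ` {1..n - k}"
  shows "prolific k n \<sigma>"
proof -
  define r where "r = n - k"
  define \<B> where "\<B> = {B. B \<subseteq> {1..n} \<and> card B = r}"
  define occ where "occ f \<pi> \<longleftrightarrow> strict_mono_on {1..r} f \<and> f ` {1..r} \<subseteq> {1..n} \<and>
    \<pi> permutes {1..r} \<and> (\<forall>a\<in>{1..r}. \<forall>b\<in>{1..r}. \<sigma> (f a) < \<sigma> (f b) \<longleftrightarrow> \<pi> a < \<pi> b)" for f \<pi>
  have "\<exists>f \<pi>. f ` {1..r} = B \<and> occ f \<pi>" if B: "B \<in> \<B>" for B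
  proof -
    have fin: "finite B" and sub: "B \<subseteq> {1..n}" and r: "card B = r"
      using B by (auto simp: \<B>_def intro: finite_subset)
    define \<rho> where "\<rho> a = card {b \<in> B. b \<le> a}" for a
    define f where "f = inv_into B \<rho>"
    have \<rho>: "bij_betw \<rho> B {1..r}" "\<And>a b. a \<in> B \<Longrightarrow> b \<in> B \<Longrightarrow> \<rho> a < \<rho> b \<longleftrightarrow> a < b"
      using bij_betw_rank[OF fin, of id] rank_less_iff[OF fin, of id] r by (simp_all add: \<rho>_def[abs_def])
    have f: "bij_betw f {1..r} B" unfolding f_def using \<rho>(1) by (rule bij_betw_inv_into)
    have f_mono: "strict_mono_on {1..r} f"
    proof (rule strict_mono_onI)
      fix a b assume "a \<in> {1..r}" "b \<in> {1..r}" "a < b"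
      then show "f a < f b"
        using \<rho>(2)[of "f a" "f b"] bij_betwE[OF f] bij_betw_inv_into_right[OF \<rho>(1)]
        by (simp add: f_def)
    qed
    have inj: "inj_on (\<lambda>a. \<sigma> (f a)) {1..r}"
      using comp_inj_on[OF bij_betw_imp_inj_on[OF f] permutes_inj_on[OF \<sigma>]] by (simp add: comp_def)
    \<comment> \<open>The word \<open>\<sigma> (f a)\<close> is replaced by its ranks, with the
      identity outside \<open>{1..r}\<close> as \<open>permutes\<close> requires.\<close>
    define \<pi> where "\<pi> a = (if a \<in> {1..r} then card {b \<in> {1..r}. \<sigma> (f b) \<le> \<sigma> (f a)} else a)" for a
    have "bij_betw \<pi> {1..r} {1..r}"
      using bij_betw_rank[OF _ inj] by (subst bij_betw_cong) (auto simp: \<pi>_def)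
    then have "\<pi> permutes {1..r}" by (rule bij_imp_permutes) (auto simp: \<pi>_def)
    moreover have "\<sigma> (f a) < \<sigma> (f b) \<longleftrightarrow> \<pi> a < \<pi> b" if "a \<in> {1..r}" "b \<in> {1..r}" for a b
      using rank_less_iff[OF _ inj that] that by (simp add: \<pi>_def)
    ultimately have "occ f \<pi>" using f_mono f sub by (simp add: occ_def bij_betw_def)
    then show ?thesis using f by (auto simp: bij_betw_def)
  qed
  then obtain F P where FP: "\<And>B. B \<in> \<B> \<Longrightarrow> F B ` {1..r} = B \<and> occ (F B) (P B)"
    by metis
  have "inj_on P \<B>"
  proof (rule inj_onI)
    fix B C assume BC: "B \<in> \<B>" "C \<in> \<B>" "P B = P C"
    then have "F B ` {1..r} = F C ` {1..r}"
      using FP[of B] FP[of C] unfolding occ_def r_def by (intro unique) auto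
    then show "B = C" using FP BC by simp
  qed
  moreover have "P ` \<B> = {\<pi>. \<pi> permutes {1..r} \<and> pattern_contained r \<pi> n \<sigma>}"
  proof (intro equalityI subsetI)
    fix \<pi> assume "\<pi> \<in> P ` \<B>"
    then obtain B where "occ (F B) \<pi>" using FP by blast
    then show "\<pi> \<in> {\<pi>. \<pi> permutes {1..r} \<and> pattern_contained r \<pi> n \<sigma>}"
      unfolding pattern_contained_def occ_def by blast
  next
    fix \<pi> assume "\<pi> \<in> {\<pi>. \<pi> permutes {1..r} \<and> pattern_contained r \<pi> n \<sigma>}"
    then obtain f where f: "occ f \<pi>" by (auto simp: pattern_contained_def occ_def)
    define B where "B = f ` {1..r}"
    have B: "B \<in> \<B>"
      using f by (auto simp: B_def \<B>_def occ_def card_image strict_mono_on_imp_inj_on)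
    have "f a = F B a" if "a \<in> {1..r}" for a
    proof (rule strict_mono_on_eqI[OF _ _ _ that])
      show "f ` {1..r} = F B ` {1..r}" using FP[OF B] B_def by metis
    qed (use f FP[OF B] in \<open>simp_all add: occ_def\<close>)
    then have "\<pi> = P B"
      using f FP[OF B] unfolding occ_def by (intro permutes_eqI[of \<pi> r]) simp_all
    then show "\<pi> \<in> P ` \<B>" using B by blast
  qed
  ultimately have "card {\<pi>. \<pi> permutes {1..r} \<and> pattern_contained r \<pi> n \<sigma>} = card \<B>"
    by (metis card_image)
  also have "\<dots> = n choose r" unfolding \<B>_def by (simp add: n_subsets)
  also have "\<dots> = n choose k" using assms(2) binomial_symmetric[of k n] by (simp add: r_def)
  finally show ?thesis using assms by (simp add: prolific_def r_def)
qed

section \<open>Short vectors of the two lattices\<close>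

lemma multiplier_in_unit_range:
  fixes s m y :: int
  assumes "s * m = y" and "\<bar>y\<bar> < 2 * m"
  shows "s = - 1 \<or> s = 0 \<or> s = 1"
proof -
  have "\<bar>s\<bar> * m < 2 * m" using assms by (auto simp: abs_mult)
  then have "\<bar>s\<bar> < 2" using mult_less_cancel_right[of "\<bar>s\<bar>" m 2] assms(2) by auto
  then show ?thesis by auto
qed

text \<open>The lattice has an orthogonal basis of two vectors of squared length
  \<open>2 * h\<^sup>2 + 2 * h + 1\<close>, so inner products with them give the coordinates times
  this number.\<close>

lemma short_vectors_odd:
  fixes h p q z :: int
  assumes "1 \<le> h" and q: "q = (2 * h + 1) * p + (2 * h\<^sup>2 + 2 * h + 1) * z"
    and "p \<noteq> 0" and p_le: "\<bar>p\<bar> \<le> 2 * h - 1" and q_le: "\<bar>q\<bar> \<le> 2 * h - 1"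
  shows "\<bar>p\<bar> = h + 1 \<and> \<bar>q\<bar> = h \<and> (0 < p \<longleftrightarrow> 0 < q) \<or>
    \<bar>p\<bar> = h \<and> \<bar>q\<bar> = h + 1 \<and> (0 < p \<longleftrightarrow> q < 0)"
proof -
  \<comment> \<open>\<open>s\<close> and \<open>t\<close> are the coordinates in the lattice basis \<open>(h + 1, h)\<close>, \<open>(h, -(h + 1))\<close>.\<close>
  define s where "s = p + h * z"
  define t where "t = - p - (h + 1) * z"
  have p: "p = s * (h + 1) + t * h" by (simp add: s_def t_def algebra_simps)
  have q': "q = s * h - t * (h + 1)"
    by (simp add: q s_def t_def algebra_simps power2_eq_square)
  have "\<bar>p * (h + 1)\<bar> \<le> (2 * h - 1) * (h + 1)" "\<bar>q * h\<bar> \<le> (2 * h - 1) * h"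
    "\<bar>p * h\<bar> \<le> (2 * h - 1) * h" "\<bar>q * (h + 1)\<bar> \<le> (2 * h - 1) * (h + 1)"
    using p_le q_le assms(1) by (auto simp: abs_mult intro: mult_right_mono)
  then have bounds: "\<bar>p * (h + 1) + q * h\<bar> < 2 * (2 * h\<^sup>2 + 2 * h + 1)"
      "\<bar>p * h - q * (h + 1)\<bar> < 2 * (2 * h\<^sup>2 + 2 * h + 1)"
    using assms(1) by (auto simp: algebra_simps power2_eq_square)
  have "s = - 1 \<or> s = 0 \<or> s = 1"
    by (rule multiplier_in_unit_range[OF _ bounds(1)]) (simp add: p q' algebra_simps power2_eq_square)
  moreover have "t = - 1 \<or> t = 0 \<or> t = 1"
    by (rule multiplier_in_unit_range[OF _ bounds(2)]) (simp add: p q' algebra_simps power2_eq_square)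
  \<comment> \<open>Coordinates \<open>s = t = 0\<close> give \<open>p = 0\<close>, and two nonzero
    coordinates give an entry of size \<open>2 * h + 1\<close>, outside the box.\<close>
  ultimately show ?thesis using p q' p_le q_le assms(1,3) by (elim disjE) auto
qed

lemma short_vectors_even:
  fixes h p q z :: int
  assumes "2 \<le> h" and q: "q = (2 * h - 1) * p + 2 * h\<^sup>2 * z"
    and "p \<noteq> 0" and p_le: "\<bar>p\<bar> \<le> 2 * h - 2" and q_le: "\<bar>q\<bar> \<le> 2 * h - 2"
  shows "\<bar>p\<bar> = h + 1 \<and> \<bar>q\<bar> = h - 1 \<and> (0 < p \<longleftrightarrow> 0 < q) \<or>
    \<bar>p\<bar> = h \<and> \<bar>q\<bar> = h \<and> (0 < p \<longleftrightarrow> q < 0)"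
proof -
  \<comment> \<open>Coordinates in the basis \<open>(h + 1, h - 1)\<close>, \<open>(h, -h)\<close>.
    It is not orthogonal; instead \<open>p + q = 2 * h * s\<close> and
    \<open>p - q - 2 * s = 2 * h * t\<close>.\<close>
  define s where "s = p + h * z"
  define t where "t = - p - (h + 1) * z"
  have p: "p = s * (h + 1) + t * h" by (simp add: s_def t_def algebra_simps)
  have q': "q = s * (h - 1) - t * h"
    by (simp add: q s_def t_def algebra_simps power2_eq_square)
  have s: "s = - 1 \<or> s = 0 \<or> s = 1"
    by (rule multiplier_in_unit_range[of _ "2 * h" "p + q"])
      (use p_le q_le assms(1) in \<open>auto simp: p q' algebra_simps\<close>)
  moreover have "t = - 1 \<or> t = 0 \<or> t = 1"
    by (rule multiplier_in_unit_range[of _ "2 * h" "p - q - 2 * s"])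
      (use p_le q_le assms(1) s in \<open>auto simp: p q' algebra_simps\<close>)
  ultimately show ?thesis using p q' p_le q_le assms(1,3) by (elim disjE) auto
qed

section \<open>Permutations given by multiplication modulo \<open>m + 1\<close>\<close>

lemma modular_permutes_prolific:
  fixes c k m :: nat and \<sigma> :: "nat \<Rightarrow> nat" and \<alpha> \<beta> \<gamma> \<delta> :: int
  assumes "1 \<le> k" and "k < m"
    and \<sigma>: "\<And>i. i \<in> {1..m} \<Longrightarrow> \<sigma> i = i * c mod (m + 1)" "\<And>i. i \<notin> {1..m} \<Longrightarrow> \<sigma> i = i"
    and coprime: "coprime c (m + 1)"
    and short: "\<And>p q z :: int. q = int c * p + (int m + 1) * z \<Longrightarrow> p \<noteq> 0 \<Longrightarrow>
      \<bar>p\<bar> \<le> int k \<Longrightarrow> \<bar>q\<bar> \<le> int k \<Longrightarrow>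
      \<bar>p\<bar> = \<alpha> \<and> \<bar>q\<bar> = \<beta> \<and> (0 < p \<longleftrightarrow> 0 < q) \<or> \<bar>p\<bar> = \<gamma> \<and> \<bar>q\<bar> = \<delta> \<and> (0 < p \<longleftrightarrow> q < 0)"
    and sizes: "\<alpha> + \<beta> = int k + 2" "\<gamma> + \<delta> = int k + 2"
      "int k < 2 * \<alpha>" "int k < 2 * \<gamma>" "int k < \<beta> + \<delta>"
  shows "\<sigma> permutes {1..m} \<and> prolific k m \<sigma>"
proof
  have inj: "inj_on \<sigma> {1..m}"
  proof (rule inj_onI)
    fix i j assume ij: "i \<in> {1..m}" "j \<in> {1..m}" "\<sigma> i = \<sigma> j"
    then have "[i * c = j * c] (mod (m + 1))" by (simp add: \<sigma>(1) cong_def)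
    then have "[i = j] (mod (m + 1))" using coprime cong_mult_rcancel_nat by blast
    then show "i = j" using ij by (simp add: cong_def)
  qed
  have "\<sigma> i \<in> {1..m}" if i: "i \<in> {1..m}" for i
  proof -
    \<comment> \<open>This excludes the residue 0.\<close>
    have "\<not> m + 1 dvd i * c"
      using i coprime by (auto simp: coprime_dvd_mult_left_iff coprime_commute dest: dvd_imp_le)
    then show ?thesis using i \<sigma>(1)[OF i] by (auto simp: dvd_eq_mod_eq_0 Suc_le_eq less_Suc_eq_le[symmetric])
  qed
  then have "\<sigma> ` {1..m} = {1..m}" using inj by (intro endo_inj_surj) auto
  then have bij_\<sigma>: "bij_betw \<sigma> {1..m} {1..m}" using inj by (simp add: bij_betw_def)
  then show perm: "\<sigma> permutes {1..m}" using \<sigma>(2) by (rule bij_imp_permutes)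
  define s where "s i = int (\<sigma> (nat i))" for i
  have "bij_betw nat {1..int m} {1..m}"
    by (rule bij_betw_byWitness[where f' = int]) auto
  from bij_betw_trans[OF this bij_\<sigma>] have "bij_betw (\<sigma> \<circ> nat) {1..int m} {1..m}" .
  moreover have "bij_betw int {1..m} {1..int m}"
    by (rule bij_betw_byWitness[where f' = nat]) auto
  ultimately have "bij_betw (int \<circ> (\<sigma> \<circ> nat)) {1..int m} {1..int m}" by (rule bij_betw_trans)
  moreover have "int \<circ> (\<sigma> \<circ> nat) = s" by (simp add: fun_eq_iff s_def)
  ultimately have bij: "bij_betw s {1..int m} {1..int m}" by simp
  have s_mod: "s i = i * int c mod (int m + 1)" if "i \<in> {1..int m}" for i
  proof -
    have "nat i \<in> {1..m}" using that by auto
    then have "s i = int (nat i * c mod (m + 1))" by (simp only: s_def \<sigma>(1))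
    then show ?thesis using that by (simp add: zmod_int add.commute)
  qed
  have vector: "\<exists>z. s j - s i = int c * (j - i) + (int m + 1) * z"
    if "i \<in> {1..int m}" "j \<in> {1..int m}" for i j
  proof
    show "s j - s i = int c * (j - i) + (int m + 1) * (i * int c div (int m + 1) - j * int c div (int m + 1))"
      unfolding s_mod[OF that(1)] s_mod[OF that(2)] minus_mult_div_eq_mod[symmetric]
      by (simp add: algebra_simps)
  qed
  have separated: "int k + 2 \<le> \<bar>i - j\<bar> + \<bar>s i - s j\<bar>"
    if ij: "i \<in> {1..int m}" "j \<in> {1..int m}" "i \<noteq> j" for i j
  proof (rule ccontr)
    assume *: "\<not> ?thesis"
    \<comment> \<open>Both differences are nonzero, so a distance below \<open>k + 2\<close> leaves
      each at most \<open>k\<close>; then \<open>short\<close> forces the distance to be exactly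
      \<open>k + 2\<close>.\<close>
    have "s i \<noteq> s j" using bij ij by (auto simp: bij_betw_def dest: inj_onD)
    then have "\<bar>i - j\<bar> \<le> int k" "\<bar>s i - s j\<bar> \<le> int k" using * ij by auto
    moreover obtain z where "s i - s j = int c * (i - j) + (int m + 1) * z"
      using vector ij by blast
    ultimately show False using short[of "s i - s j" "i - j" z] * ij sizes by auto
  qed
  show "prolific k m \<sigma>"
  proof (rule prolificI[OF assms(1,2) perm])
    fix f g
    let ?A = "{1..m - k}"
    assume f: "strict_mono_on ?A f" "f ` ?A \<subseteq> {1..m}" and g: "strict_mono_on ?A g" "g ` ?A \<subseteq> {1..m}"
      and same: "\<And>a b. a \<in> ?A \<Longrightarrow> b \<in> ?A \<Longrightarrow> \<sigma> (f a) < \<sigma> (f b) \<longleftrightarrow> \<sigma> (g a) < \<sigma> (g b)"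
    interpret X: order_twins m k ?A "\<lambda>a. int (f a)" "\<lambda>a. int (g a)"
    proof
      show "inj_on (\<lambda>a. int (f a)) ?A" using strict_mono_on_imp_inj_on[OF f(1)] by (simp add: inj_on_def)
      show "int (f a) < int (f b) \<longleftrightarrow> int (g a) < int (g b)" if "a \<in> ?A" "b \<in> ?A" for a b
        using strict_mono_on_less[OF f(1) that] strict_mono_on_less[OF g(1) that] by simp
      show "int (f a) \<in> {1..int m}" "int (g a) \<in> {1..int m}" if "a \<in> ?A" for a
        using f(2) g(2) that by force+
    qed (use assms(2) in auto)
    interpret Y: order_twins m k ?A "\<lambda>a. s (int (f a))" "\<lambda>a. s (int (g a))"
    proof
      show "inj_on (\<lambda>a. s (int (f a))) ?A"
        using strict_mono_on_imp_inj_on[OF f(1)] permutes_inj[OF perm]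
        by (auto simp: inj_on_def s_def)
      show "s (int (f a)) \<in> {1..int m}" if "a \<in> ?A" for a
        using bij_betwE[OF bij] X.range[OF that] by blast
      show "s (int (g a)) \<in> {1..int m}" if "a \<in> ?A" for a
        using bij_betwE[OF bij] X.range'[OF that] by blast
    qed (use X.finite_index X.card_index same in \<open>auto simp: s_def\<close>)
    interpret pattern_twins m k ?A "\<lambda>a. int (f a)" "\<lambda>a. int (g a)" s \<alpha> \<beta> \<gamma> \<delta>
    proof
      fix a assume a: "a \<in> ?A" "int (g a) \<noteq> int (f a)"
      obtain z where "s (int (g a)) - s (int (f a)) = int c * (int (g a) - int (f a)) + (int m + 1) * z"
        using vector X.range X.range' a by blast
      moreover have "\<bar>int (g a) - int (f a)\<bar> \<le> int k"
        using X.shift_le[OF a(1)] order_twins.shift_le[OF X.swap a(1)] by auto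
      moreover have "\<bar>s (int (g a)) - s (int (f a))\<bar> \<le> int k"
        using Y.shift_le[OF a(1)] order_twins.shift_le[OF Y.swap a(1)] by auto
      ultimately have "\<bar>int (g a) - int (f a)\<bar> = \<alpha> \<and> \<bar>s (int (g a)) - s (int (f a))\<bar> = \<beta> \<and>
          (0 < int (g a) - int (f a) \<longleftrightarrow> 0 < s (int (g a)) - s (int (f a))) \<or>
        \<bar>int (g a) - int (f a)\<bar> = \<gamma> \<and> \<bar>s (int (g a)) - s (int (f a))\<bar> = \<delta> \<and>
          (0 < int (g a) - int (f a) \<longleftrightarrow> s (int (g a)) - s (int (f a)) < 0)"
        using a(2) by (intro short) auto
      then show "\<bar>int (g a) - int (f a)\<bar> = \<alpha> \<and> \<bar>s (int (g a)) - s (int (f a))\<bar> = \<beta> \<and>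
          (int (f a) < int (g a) \<longleftrightarrow> s (int (f a)) < s (int (g a))) \<or>
        \<bar>int (g a) - int (f a)\<bar> = \<gamma> \<and> \<bar>s (int (g a)) - s (int (f a))\<bar> = \<delta> \<and>
          (int (f a) < int (g a) \<longleftrightarrow> s (int (g a)) < s (int (f a)))"
        by simp
    qed (use bij separated sizes in auto)
    show "f ` ?A = g ` ?A" using twins_equal by (intro image_cong) auto
  qed
qed

section \<open>Arithmetic of \<open>m_size\<close> and the two parities\<close>

text \<open>A common divisor divides both \<open>c * d\<close> and \<open>c * d + 1\<close>.\<close>

lemma coprime_if_mult_eq:
  fixes c d M :: nat
  assumes "c * d + 1 = 2 * M"
  shows "coprime c M"
proof (rule coprimeI)
  fix l assume "l dvd c" "l dvd M"
  then have "l dvd c * d + 1" using assms by simp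
  then show "is_unit l" using \<open>l dvd c\<close> by (metis dvd_add_right_iff dvd_mult2)
qed

lemma m_size_odd: "m_size (2 * j + 1) = 2 * j\<^sup>2 + 6 * j + 4"
proof -
  have "(real (2 * j + 1))\<^sup>2 / 2 + 2 * real (2 * j + 1) + 1
      = real_of_int (2 * int j ^ 2 + 6 * int j + 4) - 1 / 2"
    by (simp add: power2_eq_square field_simps)
  also have "\<lceil>\<dots>\<rceil> = 2 * int j ^ 2 + 6 * int j + 4" by (rule ceiling_unique) auto
  finally show ?thesis by (simp add: m_size_def nat_add_distrib nat_mult_distrib nat_power_eq)
qed

lemma m_size_even: "m_size (2 * j) = 2 * j\<^sup>2 + 4 * j + 1"
proof -
  have "(real (2 * j))\<^sup>2 / 2 + 2 * real (2 * j) + 1 = real_of_int (2 * int j ^ 2 + 4 * int j + 1)"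
    by (simp add: power2_eq_square field_simps)
  also have "\<lceil>\<dots>\<rceil> = 2 * int j ^ 2 + 4 * int j + 1" by (rule ceiling_of_int)
  finally show ?thesis by (simp add: m_size_def nat_add_distrib nat_mult_distrib nat_power_eq)
qed

theorem theorem4p2:
  fixes k :: nat
  assumes "k \<ge> 1"
  shows "sigma_perm k permutes {1..m_size k} \<and> prolific k (m_size k) (sigma_perm k)"
proof (cases "odd k")
  case True
  then obtain j where k: "k = 2 * j + 1" by (auto elim: oddE)
  define h where "h = int j + 1"
  have m: "int (m_size k) + 1 = 2 * h\<^sup>2 + 2 * h + 1"
    unfolding k m_size_odd h_def by (simp add: power2_eq_square algebra_simps)
  have c: "int (k + 2) = 2 * h + 1" by (simp add: k h_def)
  show ?thesis
  proof (rule modular_permutes_prolific[where c = "k + 2" and \<alpha> = "h + 1" and \<beta> = h and \<gamma> = h and \<delta> = "h + 1"])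
    show "coprime (k + 2) (m_size k + 1)"
      \<comment> \<open>Here \<open>d = k + 2\<close>, since
        \<open>(k + 2)\<^sup>2 + 1 = 2 * (m_size k + 1)\<close>.\<close>
      by (rule coprime_if_mult_eq[where d = "2 * j + 3"])
        (simp only: k m_size_odd, simp add: power2_eq_square algebra_simps)
    show "k < m_size k" unfolding k m_size_odd by simp
    fix p q z :: int
    assume "q = int (k + 2) * p + (int (m_size k) + 1) * z" "p \<noteq> 0" "\<bar>p\<bar> \<le> int k" "\<bar>q\<bar> \<le> int k"
    then show "\<bar>p\<bar> = h + 1 \<and> \<bar>q\<bar> = h \<and> (0 < p \<longleftrightarrow> 0 < q) \<or> \<bar>p\<bar> = h \<and> \<bar>q\<bar> = h + 1 \<and> (0 < p \<longleftrightarrow> q < 0)"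
      unfolding m c by (intro short_vectors_odd[of h q p z]) (auto simp: k h_def)
  qed (use assms True in \<open>auto simp: sigma_perm_def k h_def\<close>)
next
  case False
  then obtain j where k: "k = 2 * j" by (auto elim: evenE)
  define h where "h = int j + 1"
  have m: "int (m_size k) + 1 = 2 * h\<^sup>2"
    unfolding k m_size_even h_def by (simp add: power2_eq_square algebra_simps)
  have c: "int (k + 1) = 2 * h - 1" by (simp add: k h_def)
  show ?thesis
  proof (rule modular_permutes_prolific[where c = "k + 1" and \<alpha> = "h + 1" and \<beta> = "h - 1" and \<gamma> = h and \<delta> = h])
    show "coprime (k + 1) (m_size k + 1)"
      \<comment> \<open>Here \<open>d = k + 3\<close>, since
        \<open>(k + 1) * (k + 3) + 1 = 2 * (m_size k + 1)\<close>.\<close>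
      by (rule coprime_if_mult_eq[where d = "2 * j + 3"])
        (simp only: k m_size_even, simp add: power2_eq_square algebra_simps)
    show "k < m_size k" unfolding k m_size_even by simp
    fix p q z :: int
    assume "q = int (k + 1) * p + (int (m_size k) + 1) * z" "p \<noteq> 0" "\<bar>p\<bar> \<le> int k" "\<bar>q\<bar> \<le> int k"
    then show "\<bar>p\<bar> = h + 1 \<and> \<bar>q\<bar> = h - 1 \<and> (0 < p \<longleftrightarrow> 0 < q) \<or> \<bar>p\<bar> = h \<and> \<bar>q\<bar> = h \<and> (0 < p \<longleftrightarrow> q < 0)"
      unfolding m c using assms by (intro short_vectors_even[of h q p z]) (auto simp: k h_def)
  qed (use assms False in \<open>auto simp: sigma_perm_def k h_def\<close>)
qed

end
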